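(* Let $T$ be a linear operator acting on a complex Hilbert space $\mathcal{H}$ with $\|T\| \le 1$. Let $x \in \mathcal{H}$ and, for $n\ge 1$, denote $S_n(T) x := x + Tx + \dots + T^{n-1}x$. Suppose that $$\sum_{k=0}^\infty k\, \| T^{*k} x \| < \infty ,$$ $$\|S_n(T)x\| = o(\sqrt{n}) \quad (n\to \infty),$$ and $$\sum_{k=1}^{n} \left(\|S_k(T)x\|^2 - \|TS_k(T)x\|^2 \right) = o(n) \quad (n\to \infty).$$ Then there exists $y \in \mathcal{H}$ such that $x = (I-T)y$. In addition, $y$ can be chosen such that $\|Ty\| = \|y\|$.
   Context: $T^*$ is the Hilbert space adjoint of $T$, $T^{*k}=(T^* )^k$, and $I$ is the identity operator. *)

theory Defs
  imports "HOL-Analysis.Analysis" "HOL-Library.Landau_Symbols"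
begin

section \<open>Complex Hilbert spaces\<close>

text \<open>
  A complex inner product space is presented as a real inner product space with a compatible
  complex scalar multiplication and a sesquilinear form whose real part is the given real inner
  product. Thus \<open>norm x ^ 2 = Re (cinner x x)\<close>, which is the norm of the complex space, and
  positive definiteness of \<open>cinner\<close> is inherited from \<open>inner\<close>.
  The form is linear in the first argument.
\<close>

class complex_inner = real_inner +
  fixes scaleC :: "complex \<Rightarrow> 'a \<Rightarrow> 'a" (infixr "*\<^sub>C" 75)
    and cinner :: "'a \<Rightarrow> 'a \<Rightarrow> complex"
  assumes scaleC_add_right: "c *\<^sub>C (x + y) = c *\<^sub>C x + c *\<^sub>C y"
    and scaleC_add_left: "(c + d) *\<^sub>C x = c *\<^sub>C x + d *\<^sub>C x"
    and scaleC_scaleC: "c *\<^sub>C d *\<^sub>C x = (c * d) *\<^sub>C x"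
    and scaleC_complex_of_real: "complex_of_real r *\<^sub>C x = r *\<^sub>R x"
    and cinner_commute: "cinner x y = cnj (cinner y x)"
    and cinner_add_left: "cinner (x + y) z = cinner x z + cinner y z"
    and cinner_scaleC_left: "cinner (c *\<^sub>C x) y = c * cinner x y"
    and Re_cinner: "Re (cinner x y) = inner x y"

class complex_hilbert_space = complex_inner + complete_space

subclass (in complex_hilbert_space) banach ..

instantiation complex :: complex_hilbert_space
begin

definition scaleC_complex :: "complex \<Rightarrow> complex \<Rightarrow> complex"
  where "scaleC_complex c x = c * x"

definition cinner_complex :: "complex \<Rightarrow> complex \<Rightarrow> complex"
  where "cinner_complex x y = x * cnj y"

instance
  by standard
    (auto simp: scaleC_complex_def cinner_complex_def inner_complex_def algebra_simps
      scaleR_conv_of_real)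

end

lemma cinner_self: "cinner x x = complex_of_real ((norm x)\<^sup>2)"
  for x :: "'a::complex_inner"
proof (rule complex_eqI)
  have "Im (cinner x x) = - Im (cinner x x)"
    using arg_cong[OF cinner_commute[of x x], of Im] by simp
  then show "Im (cinner x x) = Im (complex_of_real ((norm x)\<^sup>2))"
    by simp
qed (simp add: Re_cinner power2_norm_eq_inner)

section \<open>Bounded operators and the Hilbert space adjoint\<close>

locale bounded_clinear = bounded_linear T
  for T :: "'a::complex_inner \<Rightarrow> 'b::complex_inner" +
  assumes scaleC: "T (c *\<^sub>C x) = c *\<^sub>C T x"

definition cadjoint :: "('a::complex_inner \<Rightarrow> 'b::complex_inner) \<Rightarrow> 'b \<Rightarrow> 'a"
  where "cadjoint T = (THE S. \<forall>x y. cinner (T x) y = cinner x (S y))"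

text \<open>
  The following facts show that the description defining \<open>cadjoint\<close> is proper for bounded
  operators on a complex Hilbert space.
\<close>

lemma riesz_real:
  fixes f :: "'a::{real_inner,complete_space} \<Rightarrow> real"
  assumes "bounded_linear f"
  obtains z where "\<And>x. f x = inner x z"
proof -
  interpret f: bounded_linear f by fact
  define \<phi> where "\<phi> x = (norm x)\<^sup>2 / 2 - f x" for x
  obtain K where K: "\<And>x. norm (f x) \<le> norm x * K"
    using f.bounded by blast
  have lower: "- (K\<^sup>2 / 2) \<le> \<phi> x" for x
  proof -
    have "f x \<le> norm x * K" using K[of x] by simp
    moreover have "0 \<le> (norm x - K)\<^sup>2" by simp
    ultimately show ?thesis
      unfolding \<phi>_def by (simp add: power2_diff field_simps)
  qed
  define m where "m = (INF x. \<phi> x)"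
  have bdd: "bdd_below (range \<phi>)"
    using lower by (auto intro!: bdd_belowI)
  have m_le: "m \<le> \<phi> x" for x
    unfolding m_def using bdd by (rule cINF_lower) simp
  have "\<exists>x. \<phi> x < m + inverse (real (Suc n))" for n
  proof -
    have "Inf (range \<phi>) < m + inverse (real (Suc n))"
      by (simp add: m_def)
    then show ?thesis
      using cInf_less_iff[OF _ bdd] by auto
  qed
  then obtain X where X: "\<And>n. \<phi> (X n) < m + inverse (real (Suc n))"
    by metis
  have par: "(norm (x - y))\<^sup>2 / 4 = \<phi> x + \<phi> y - 2 * \<phi> ((1/2) *\<^sub>R (x + y))" for x y
    unfolding \<phi>_def
    by (simp add: f.scaleR f.add power2_norm_eq_inner inner_simps inner_commute field_simps)
  have dist2: "(dist (X i) (X j))\<^sup>2 \<le> 8 * inverse (real (Suc N))" if "i \<ge> N" "j \<ge> N" for i j N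
  proof -
    have "inverse (real (Suc i)) \<le> inverse (real (Suc N))"
      "inverse (real (Suc j)) \<le> inverse (real (Suc N))"
      using that by auto
    then show ?thesis
      using par[of "X i" "X j"] m_le[of "(1/2) *\<^sub>R (X i + X j)"] X[of i] X[of j]
      unfolding dist_norm by linarith
  qed
  have "Cauchy X"
  proof (rule metric_CauchyI)
    fix e :: real assume "0 < e"
    then have "0 < e\<^sup>2 / 8" by simp
    then obtain N where N: "inverse (real (Suc N)) < e\<^sup>2 / 8"
      using reals_Archimedean by blast
    have "dist (X i) (X j) < e" if "i \<ge> N" "j \<ge> N" for i j
    proof (rule power_less_imp_less_base)
      show "(dist (X i) (X j))\<^sup>2 < e\<^sup>2"
        using dist2[OF that] N by linarith
    qed (use \<open>0 < e\<close> in simp)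
    then show "\<exists>M. \<forall>i\<ge>M. \<forall>j\<ge>M. dist (X i) (X j) < e" by blast
  qed
  then obtain z where z: "X \<longlonglongrightarrow> z"
    using Cauchy_convergent convergent_def by blast
  have "(\<lambda>n. \<phi> (X n)) \<longlonglongrightarrow> \<phi> z"
    unfolding \<phi>_def by (intro tendsto_intros z f.tendsto) simp
  moreover have "(\<lambda>n. m + inverse (real (Suc n))) \<longlonglongrightarrow> m + 0"
    by (intro tendsto_intros LIMSEQ_inverse_real_of_nat)
  ultimately have "\<phi> z \<le> m + 0"
    by (rule LIMSEQ_le) (use X less_imp_le in blast)
  then have z_min: "\<phi> z \<le> \<phi> x" for x
    using m_le[of x] by simp
  have "f x = inner x z" for x
  proof (rule ccontr)
    assume ne: "f x \<noteq> inner x z"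
    define a where "a = inner x z - f x"
    define q where "q = (norm x)\<^sup>2"
    have a0: "a \<noteq> 0" using ne by (simp add: a_def)
    have q: "0 \<le> q" by (simp add: q_def)
    have expand: "0 \<le> t * a + t\<^sup>2 * q / 2" for t
    proof -
      have "(norm (z + t *\<^sub>R x))\<^sup>2 = (norm z)\<^sup>2 + 2 * (t * inner x z) + t\<^sup>2 * q"
        unfolding q_def power2_norm_eq_inner power2_eq_square[of t]
        by (simp add: inner_simps inner_commute)
      then show ?thesis
        using z_min[of "z + t *\<^sub>R x"] unfolding \<phi>_def a_def
        by (simp add: f.add f.scaleR field_simps)
    qed
    define t where "t = - a / (q + 1)"
    have t0: "t \<noteq> 0" and a_eq: "a = - t * (q + 1)"
      using a0 q by (simp_all add: t_def)
    have "t * a + t\<^sup>2 * q / 2 = - (t\<^sup>2 * (q / 2 + 1))"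
      unfolding a_eq by (simp add: power2_eq_square algebra_simps)
    moreover have "0 < t\<^sup>2 * (q / 2 + 1)"
      using q t0 by (intro mult_pos_pos) auto
    ultimately show False
      using expand[of t] by linarith
  qed
  then show thesis by (rule that)
qed

lemma cinner_eqI_right:
  fixes u v :: "'a::complex_inner"
  assumes "\<And>x. cinner x u = cinner x v"
  shows "u = v"
proof -
  have "inner (u - v) u = inner (u - v) v"
    using arg_cong[OF assms[of "u - v"], of Re] unfolding Re_cinner .
  then have "inner (u - v) (u - v) = 0"
    unfolding inner_diff_right[of "u - v"] by simp
  then show ?thesis
    by simp
qed

lemma cadjoint_unique:
  assumes "\<And>x y. cinner (T x) y = cinner x (S y)"
  shows "cadjoint T = S"
  unfolding cadjoint_def
proof (rule the_equality)
  fix S' assume "\<forall>x y. cinner (T x) y = cinner x (S' y)"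
  then show "S' = S"
    using assms by (metis cinner_eqI_right ext)
qed (use assms in simp)

lemma cinner_cadjoint:
  fixes T :: "'a::complex_hilbert_space \<Rightarrow> 'b::complex_inner"
  assumes "bounded_clinear T"
  shows "cinner (T x) y = cinner x (cadjoint T y)"
proof -
  interpret bounded_clinear T by fact
  have "\<exists>z. \<forall>x. inner (T x) y = inner x z" for y
  proof -
    have "bounded_linear (\<lambda>x. inner (T x) y)"
      using bounded_linear_compose[OF bounded_linear_inner_left bounded_linear_axioms] .
    then obtain z where "\<And>x. inner (T x) y = inner x z"
      using riesz_real by blast
    then show ?thesis by blast
  qed
  then obtain S where S: "\<And>x y. inner (T x) y = inner x (S y)"
    by metis
  have "cinner (T x) y = cinner x (S y)" for x y
  proof (rule complex_eqI)
    show "Re (cinner (T x) y) = Re (cinner x (S y))"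
      by (simp add: Re_cinner S)
    have "Re (\<i> * cinner (T x) y) = Re (\<i> * cinner x (S y))"
      by (metis Re_cinner S cinner_scaleC_left scaleC)
    then show "Im (cinner (T x) y) = Im (cinner x (S y))"
      by simp
  qed
  then show ?thesis
    using cadjoint_unique[of T S] by simp
qed

section \<open>Partial sums along an orbit\<close>

definition orbit_sum :: "('a::comm_monoid_add \<Rightarrow> 'a) \<Rightarrow> nat \<Rightarrow> 'a \<Rightarrow> 'a"
  where "orbit_sum T n x = (\<Sum>k<n. (T ^^ k) x)"

end

theory Submission
  imports Defs
begin

text \<open>
  Expanding \<open>norm (x + T (S k x))\<close> gives an exact formula for \<open>(norm (S n x))\<^sup>2\<close> as a sum of
  correlation terms minus the sum of the defects \<open>(norm (S k x))\<^sup>2 - (norm (T (S k x)))\<^sup>2\<close>.  The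
  correlation terms converge to a constant, which the two little-o hypotheses force to be \<open>0\<close>; their
  distance to the limit has bounded partial sums by the weighted summability hypothesis, so the
  \<open>S n x\<close> are bounded.  Their Cesaro means \<open>y\<close> are therefore bounded and satisfy \<open>y - T y \<longlonglongrightarrow> x\<close> and
  \<open>y - T\<^sup>* (T y) \<longlonglongrightarrow> 0\<close>.  Since bounded operators on a Hilbert space map closed balls to closed
  sets, both limits are attained at a single vector.
\<close>

section \<open>Limits attained along bounded sequences in Hilbert space\<close>

text \<open>This stands in for weak compactness of balls. The approximate solution sets
  \<open>C n\<close> are convex, decreasing, and each meets the ball of radius \<open>M\<close>; by
  the parallelogram law, elements of nearly minimal norm in them form a Cauchy sequence, whose limit
  solves the equation.\<close>

lemma bounded_linear_limit_attained:
  fixes L :: "'a::{real_inner,complete_space} \<Rightarrow> 'b::real_normed_vector"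
  assumes L: "bounded_linear L"
    and bound: "\<And>n. norm (u n) \<le> M"
    and lim: "(\<lambda>n. L (u n)) \<longlonglongrightarrow> w"
  obtains y where "L y = w"
proof -
  interpret L: bounded_linear L by fact
  define e where "e n = inverse (real (Suc n))" for n
  have e_pos: "e n > 0" and e_mono: "m \<le> n \<Longrightarrow> e n \<le> e m" for m n
    by (auto simp: e_def)
  have e_lim: "e \<longlonglongrightarrow> 0"
    unfolding e_def by (rule LIMSEQ_inverse_real_of_nat)
  define C where "C n = {v. norm (L v - w) \<le> e n}" for n
  have C_mid: "(1/2) *\<^sub>R (v + v') \<in> C n" if "v \<in> C n" "v' \<in> C n" for v v' n
  proof -
    have "L ((1/2) *\<^sub>R (v + v')) - w = (1/2) *\<^sub>R ((L v - w) + (L v' - w))"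
      by (simp add: L.scaleR L.add algebra_simps flip: scaleR_add_left)
    also have "norm \<dots> \<le> (1/2) * (norm (L v - w) + norm (L v' - w))"
      using norm_triangle_ineq[of "L v - w" "L v' - w"] by simp
    finally show ?thesis using that unfolding C_def by simp
  qed
  have C_anti: "C n \<subseteq> C m" if "m \<le> n" for m n
    using e_mono[OF that] unfolding C_def by auto
  have C_small: "\<exists>v\<in>C n. (norm v)\<^sup>2 \<le> M\<^sup>2" for n
  proof -
    have "\<forall>\<^sub>F k in sequentially. dist (L (u k)) w < e n"
      using lim e_pos by (rule tendstoD)
    then obtain k where "dist (L (u k)) w < e n"
      by (meson eventually_sequentially order_refl)
    then have "u k \<in> C n" by (simp add: C_def dist_norm)
    moreover have "(norm (u k))\<^sup>2 \<le> M\<^sup>2"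
      using bound by (intro power_mono) auto
    ultimately show ?thesis by blast
  qed
  \<comment> \<open>\<open>m n\<close> is the squared distance of \<open>C n\<close> from the
    origin. It grows as the sets shrink and stays below \<open>M\<^sup>2\<close>, so it
    converges.\<close>
  define m where "m n = (INF v\<in>C n. (norm v)\<^sup>2)" for n
  have bdd: "bdd_below ((\<lambda>v. (norm v)\<^sup>2) ` C n)" for n
    by (rule bdd_belowI2[of _ 0]) simp
  have ne: "C n \<noteq> {}" for n
    using C_small by blast
  have m_le: "m n \<le> (norm v)\<^sup>2" if "v \<in> C n" for n v
    unfolding m_def using bdd that by (rule cINF_lower)
  have "incseq m"
    unfolding incseq_def m_def
    by (intro allI impI cINF_superset_mono ne bdd C_anti) auto
  moreover have "m n \<le> M\<^sup>2" for n
    using C_small m_le order_trans by meson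
  ultimately obtain l where l: "m \<longlonglongrightarrow> l" and m_le_l: "\<And>n. m n \<le> l"
    using incseq_convergent by metis
  have "\<exists>v\<in>C n. (norm v)\<^sup>2 < m n + e n" for n
    using cINF_less_iff[OF ne bdd, of n "m n + e n"] e_pos[of n] unfolding m_def by simp
  then obtain v where v: "\<And>n. v n \<in> C n" "\<And>n. (norm (v n))\<^sup>2 < m n + e n"
    by metis
  have vC: "v n \<in> C N" if "N \<le> n" for n N
    using v(1) C_anti[OF that] by blast
  \<comment> \<open>The midpoint of \<open>v i\<close> and \<open>v j\<close> stays in
    \<open>C N\<close>, so its squared norm is at least \<open>m N\<close>, while both endpoints
    have squared norm at most \<open>l + e N\<close>.\<close>
  have dist2: "(dist (v i) (v j))\<^sup>2 \<le> 4 * l - 4 * m N + 4 * e N" if "N \<le> i" "N \<le> j" for i j N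
  proof -
    define mid where "mid = (1/2) *\<^sub>R (v i + v j)"
    have "(norm (v i - v j))\<^sup>2 = 2 * (norm (v i))\<^sup>2 + 2 * (norm (v j))\<^sup>2 - 4 * (norm mid)\<^sup>2"
      unfolding mid_def
      by (simp add: power2_norm_eq_inner inner_simps inner_commute field_simps)
    moreover have "m N \<le> (norm mid)\<^sup>2"
      unfolding mid_def by (intro m_le C_mid vC that)
    moreover have "(norm (v i))\<^sup>2 \<le> l + e N" "(norm (v j))\<^sup>2 \<le> l + e N"
      using v(2)[of i] v(2)[of j] m_le_l[of i] m_le_l[of j] e_mono[OF that(1)] e_mono[OF that(2)]
      by linarith+
    ultimately show ?thesis
      unfolding dist_norm by linarith
  qed
  have "(\<lambda>N. 4 * l - 4 * m N + 4 * e N) \<longlonglongrightarrow> 4 * l - 4 * l + 4 * 0"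
    by (intro tendsto_intros l e_lim)
  then have gap: "(\<lambda>N. 4 * l - 4 * m N + 4 * e N) \<longlonglongrightarrow> 0" by simp
  have "Cauchy v"
  proof (rule metric_CauchyI)
    fix r :: real assume "0 < r"
    then have "\<forall>\<^sub>F N in sequentially. 4 * l - 4 * m N + 4 * e N < r\<^sup>2"
      using gap by (intro order_tendstoD(2)) auto
    then obtain N where N: "4 * l - 4 * m N + 4 * e N < r\<^sup>2"
      by (meson eventually_sequentially order_refl)
    have "dist (v i) (v j) < r" if "i \<ge> N" "j \<ge> N" for i j
      by (rule power_less_imp_less_base[of _ 2]) (use dist2[OF that] N \<open>0 < r\<close> in linarith)+
    then show "\<exists>N. \<forall>i\<ge>N. \<forall>j\<ge>N. dist (v i) (v j) < r" by blast
  qed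
  then obtain y where y: "v \<longlonglongrightarrow> y"
    using Cauchy_convergent convergent_def by blast
  have "(\<lambda>n. L (v n) - w) \<longlonglongrightarrow> 0"
    using v(1) by (intro Lim_null_comparison[OF _ e_lim]) (auto simp: C_def)
  then have "(\<lambda>n. L (v n)) \<longlonglongrightarrow> w"
    by (rule LIM_zero_cancel)
  with L.tendsto[OF y] have "L y = w"
    by (rule LIMSEQ_unique)
  then show thesis by (rule that)
qed

section \<open>Sums of tails of a weighted summable series\<close>

text \<open>Counting occurrences: \<open>b j\<close> lies in exactly the tails starting at 0, ...,
  \<open>j\<close>, hence is counted at most \<open>Suc j\<close> times.\<close>

lemma sum_tails_le:
  fixes b :: "nat \<Rightarrow> real"
  assumes nonneg: "\<And>j. 0 \<le> b j"
    and summable: "summable (\<lambda>j. real (Suc j) * b j)"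
  shows "(\<Sum>k<n. \<Sum>j. b (j + k)) \<le> (\<Sum>j. real (Suc j) * b j)"
proof -
  have b: "summable b"
  proof (rule summable_comparison_test'[OF summable, of 0])
    show "norm (b j) \<le> real (Suc j) * b j" for j
      using nonneg[of j] by (simp add: algebra_simps)
  qed
  \<comment> \<open>The exact count for \<open>n\<close> tails: terms of index below
    \<open>n\<close> occur \<open>Suc k\<close> times, all later ones \<open>n\<close>
    times.\<close>
  have "(\<Sum>k<n. \<Sum>j. b (j + k)) = (\<Sum>k<n. real (Suc k) * b k) + real n * (\<Sum>j. b (j + n))"
  proof (induction n)
    case (Suc n)
    have "(\<Sum>j. b (j + n)) = b n + (\<Sum>j. b (j + Suc n))"
      using suminf_split_head[OF summable_ignore_initial_segment[OF b, of n]] by simp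
    with Suc show ?case by (simp add: algebra_simps)
  qed simp
  also have "real n * (\<Sum>j. b (j + n)) = (\<Sum>j. real n * b (j + n))"
    by (rule suminf_mult[symmetric]) (rule summable_ignore_initial_segment[OF b])
  also have "\<dots> \<le> (\<Sum>j. real (Suc (j + n)) * b (j + n))"
    using nonneg
    by (intro suminf_le mult_right_mono summable_mult summable_ignore_initial_segment[OF b]
        summable_ignore_initial_segment[OF summable, of n]) auto
  also have "(\<Sum>k<n. real (Suc k) * b k) + \<dots> = (\<Sum>j. real (Suc j) * b j)"
    using suminf_split_initial_segment[OF summable, of n] by simp
  finally show ?thesis by simp
qed

lemma tail_sums_bounded:
  fixes c :: "nat \<Rightarrow> real"
  assumes "summable (\<lambda>j. real (Suc j) * \<bar>c j\<bar>)"
  shows "\<bar>\<Sum>k<n. \<Sum>j. c (j + k)\<bar> \<le> (\<Sum>j. real (Suc j) * \<bar>c j\<bar>)"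
proof -
  have "summable (\<lambda>j. \<bar>c j\<bar>)"
    by (rule summable_comparison_test'[OF assms, of 0]) (simp add: algebra_simps)
  then have "\<bar>\<Sum>j. c (j + k)\<bar> \<le> (\<Sum>j. \<bar>c (j + k)\<bar>)" for k
    by (intro summable_rabs summable_ignore_initial_segment[of "\<lambda>j. \<bar>c j\<bar>"])
  then have "\<bar>\<Sum>k<n. \<Sum>j. c (j + k)\<bar> \<le> (\<Sum>k<n. \<Sum>j. \<bar>c (j + k)\<bar>)"
    by (intro order_trans[OF sum_abs] sum_mono)
  also have "\<dots> \<le> (\<Sum>j. real (Suc j) * \<bar>c j\<bar>)"
    using assms by (intro sum_tails_le) auto
  finally show ?thesis .
qed

section \<open>The adjoint of a contraction, in terms of the real inner product\<close>

lemma inner_cadjoint: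
  fixes T :: "'a::complex_hilbert_space \<Rightarrow> 'b::complex_inner"
  assumes "bounded_clinear T"
  shows "inner (T u) v = inner u (cadjoint T v)"
  using arg_cong[OF cinner_cadjoint[OF assms, of u v], of Re] by (simp add: Re_cinner)

lemma inner_funpow_cadjoint:
  fixes T :: "'a::complex_hilbert_space \<Rightarrow> 'a"
  assumes "bounded_clinear T"
  shows "inner ((T ^^ k) u) v = inner u ((cadjoint T ^^ k) v)"
proof (induction k arbitrary: v)
  case (Suc k)
  then show ?case
    by (simp add: inner_cadjoint[OF assms]) (simp add: funpow_swap1)
qed simp

lemma norm_contraction:
  assumes "bounded_linear T" "onorm T \<le> 1"
  shows "norm (T u) \<le> norm u"
proof -
  have "norm (T u) \<le> onorm T * norm u"
    by (rule onorm[OF assms(1)])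
  also have "\<dots> \<le> 1 * norm u"
    by (rule mult_right_mono[OF assms(2)]) simp
  finally show ?thesis by simp
qed

lemma norm_cadjoint_contraction:
  fixes T :: "'a::complex_hilbert_space \<Rightarrow> 'b::complex_inner"
  assumes T: "bounded_clinear T" "onorm T \<le> 1"
  shows "norm (cadjoint T v) \<le> norm v"
proof -
  have "(norm (cadjoint T v))\<^sup>2 = inner (T (cadjoint T v)) v"
    by (simp add: inner_cadjoint[OF T(1)] power2_norm_eq_inner)
  also have "\<dots> \<le> norm (T (cadjoint T v)) * norm v"
    by (rule norm_cauchy_schwarz)
  also have "\<dots> \<le> norm (cadjoint T v) * norm v"
    using T by (intro mult_right_mono norm_contraction) (auto simp: bounded_clinear_def)
  finally show ?thesis
    by (cases "cadjoint T v = 0") (auto simp: power2_eq_square)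
qed

lemma bounded_linear_cadjoint_contraction:
  fixes T :: "'a::complex_hilbert_space \<Rightarrow> 'b::complex_inner"
  assumes "bounded_clinear T" "onorm T \<le> 1"
  shows "bounded_linear (cadjoint T)"
proof (rule bounded_linear_intro)
  fix u v r
  have "inner z (cadjoint T (u + v)) = inner z (cadjoint T u + cadjoint T v)" for z
    by (simp add: inner_right_distrib flip: inner_cadjoint[OF assms(1)])
  then show "cadjoint T (u + v) = cadjoint T u + cadjoint T v"
    using vector_eq_ldot by blast
  have "inner z (cadjoint T (r *\<^sub>R u)) = inner z (r *\<^sub>R cadjoint T u)" for z
    by (simp flip: inner_cadjoint[OF assms(1)])
  then show "cadjoint T (r *\<^sub>R u) = r *\<^sub>R cadjoint T u"
    using vector_eq_ldot by blast
  show "norm (cadjoint T u) \<le> norm u * 1"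
    using norm_cadjoint_contraction[OF assms] by simp
qed

text \<open>Each cross term of the expanded square equals the squared norm of \<open>T u\<close>,
  and the adjoint is again a contraction. A small loss of norm under \<open>T\<close> thus means
  that \<open>u\<close> is almost fixed by \<open>T\<^sup>* T\<close>.\<close>

lemma norm_defect_le:
  fixes T :: "'a::complex_hilbert_space \<Rightarrow> 'b::complex_inner"
  assumes "bounded_clinear T" "onorm T \<le> 1"
  shows "(norm (u - cadjoint T (T u)))\<^sup>2 \<le> (norm u)\<^sup>2 - (norm (T u))\<^sup>2"
proof -
  have "(norm (u - cadjoint T (T u)))\<^sup>2
      = (norm u)\<^sup>2 - 2 * (norm (T u))\<^sup>2 + (norm (cadjoint T (T u)))\<^sup>2"
    using inner_cadjoint[OF assms(1), of u "T u"]
    by (simp add: power2_norm_eq_inner inner_simps inner_commute)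
  moreover have "(norm (cadjoint T (T u)))\<^sup>2 \<le> (norm (T u))\<^sup>2"
    by (intro power_mono norm_cadjoint_contraction assms) simp
  ultimately show ?thesis by linarith
qed

section \<open>Orbit sums and their means\<close>

lemma orbit_sum_Suc:
  fixes T :: "'a::real_normed_vector \<Rightarrow> 'a"
  assumes "linear T"
  shows "orbit_sum T (Suc k) x = x + T (orbit_sum T k x)"
  unfolding orbit_sum_def sum.lessThan_Suc_shift
  by (simp add: linear_sum[OF assms] o_def)

text \<open>In the square of \<open>x + T (orbit_sum T n x)\<close>, moving the powers of
  \<open>T\<close> across the inner product turns the cross term into correlations. Writing the last
  square as that of \<open>orbit_sum T n x\<close> minus its defect gives a recursion in
  \<open>n\<close>.\<close>

lemma norm_orbit_sum_eq:
  fixes T :: "'a::complex_hilbert_space \<Rightarrow> 'a"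
  assumes T: "bounded_clinear T"
  shows "(norm (orbit_sum T n x))\<^sup>2
    = (\<Sum>k<n. (norm x)\<^sup>2 + 2 * (\<Sum>j<k. inner x ((cadjoint T ^^ Suc j) x)))
      - (\<Sum>k<n. (norm (orbit_sum T k x))\<^sup>2 - (norm (T (orbit_sum T k x)))\<^sup>2)"
proof (induction n)
  case 0
  show ?case by (simp add: orbit_sum_def)
next
  case (Suc n)
  interpret T: bounded_clinear T by fact
  have "inner x (T (orbit_sum T n x)) = (\<Sum>j<n. inner ((T ^^ Suc j) x) x)"
    by (simp add: orbit_sum_def T.sum inner_sum_right inner_commute)
  also have "\<dots> = (\<Sum>j<n. inner x ((cadjoint T ^^ Suc j) x))"
    by (simp only: inner_funpow_cadjoint[OF T])
  finally have "(norm (orbit_sum T (Suc n) x))\<^sup>2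
    = (norm x)\<^sup>2 + 2 * (\<Sum>j<n. inner x ((cadjoint T ^^ Suc j) x)) + (norm (T (orbit_sum T n x)))\<^sup>2"
    unfolding orbit_sum_Suc[OF T.linear_axioms]
    by (simp add: power2_norm_eq_inner inner_simps inner_commute)
  with Suc show ?case by simp
qed

lemma mean_orbit_sum:
  fixes T :: "'a::real_normed_vector \<Rightarrow> 'a" and x :: 'a
  assumes "linear T" "n > 0"
  defines "y \<equiv> (1 / real n) *\<^sub>R (\<Sum>k<n. orbit_sum T k x)"
  shows "y - T y = x - (1 / real n) *\<^sub>R orbit_sum T n x"
proof -
  have tel: "s - T s = x - (T ^^ k) x" if "s = orbit_sum T k x" for s k
  proof -
    have "orbit_sum T (Suc k) x = s + (T ^^ k) x"
      using that by (simp add: orbit_sum_def)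
    then show ?thesis
      using orbit_sum_Suc[OF assms(1), of k x] that by (simp add: algebra_simps)
  qed
  have "y - T y = (1 / real n) *\<^sub>R (\<Sum>k<n. orbit_sum T k x - T (orbit_sum T k x))"
    unfolding y_def
    by (simp add: linear_cmul[OF assms(1)] linear_sum[OF assms(1)] o_def sum_subtractf
        scaleR_diff_right)
  also have "(\<Sum>k<n. orbit_sum T k x - T (orbit_sum T k x)) = (\<Sum>k<n. x - (T ^^ k) x)"
    by (intro sum.cong refl tel)
  also have "\<dots> = real n *\<^sub>R x - orbit_sum T n x"
    by (simp add: sum_subtractf orbit_sum_def sum_constant_scaleR)
  finally show ?thesis using assms(2) by (simp add: scaleR_diff_right)
qed

text \<open>Convexity of the squared norm; it passes the averaged defects on to the mean
  vector.\<close>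

lemma norm_mean_power2_le:
  fixes z :: "nat \<Rightarrow> 'a::real_normed_vector"
  assumes "n > 0"
  shows "(norm ((1 / real n) *\<^sub>R (\<Sum>k<n. z k)))\<^sup>2 \<le> (\<Sum>k<n. (norm (z k))\<^sup>2) / real n"
proof -
  have "(norm (\<Sum>k<n. z k))\<^sup>2 \<le> (\<Sum>k<n. norm (z k))\<^sup>2"
    by (intro power_mono norm_sum) simp
  also have "\<dots> \<le> (\<Sum>k<n. (norm (z k))\<^sup>2) * real n"
    using sum_squared_le_sum_of_squares[of "\<lambda>k. norm (z k)" "{..<n}"] by simp
  finally show ?thesis
    using assms by (simp add: power_divide field_simps power2_eq_square)
qed

section \<open>Boundedness of the orbit sums and passage to the limit\<close>

theorem theorem1p5:
  fixes T :: "'a::complex_hilbert_space \<Rightarrow> 'a" and x :: 'a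
  assumes "bounded_clinear T"
    and "onorm T \<le> 1"
    and "summable (\<lambda>k. real k * norm ((cadjoint T ^^ k) x))"
    and "(\<lambda>n. norm (orbit_sum T n x)) \<in> o(\<lambda>n. sqrt (real n))"
    and "(\<lambda>n. \<Sum>k=1..n. (norm (orbit_sum T k x))\<^sup>2 - (norm (T (orbit_sum T k x)))\<^sup>2)
           \<in> o(\<lambda>n. real n)"
  shows "\<exists>y. x = y - T y \<and> norm (T y) = norm y"
proof -
  interpret T: bounded_clinear T by (rule assms(1))
  define s where "s k = orbit_sum T k x" for k
  define d where "d k = (norm (s k))\<^sup>2 - (norm (T (s k)))\<^sup>2" for k
  \<comment> \<open>Correlations start at the first power, so the weight \<open>k\<close> of the
    hypothesis becomes \<open>Suc j\<close>.\<close>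
  define c where "c j = inner x ((cadjoint T ^^ Suc j) x)" for j
  \<comment> \<open>\<open>A\<close> is the limit of the correlation terms in the norm formula;
    \<open>R n\<close> accumulates the tails that separate them from it.\<close>
  define A where "A = (norm x)\<^sup>2 + 2 * (\<Sum>j. c j)"
  define R where "R n = (\<Sum>k<n. \<Sum>j. c (j + k))" for n
  define K where "K = (\<Sum>j. real (Suc j) * \<bar>c j\<bar>)"
  have d_nonneg: "0 \<le> d k" for k
    unfolding d_def using norm_contraction[OF T.bounded_linear_axioms assms(2)]
    by (simp add: power_mono)
  have summable_c: "summable (\<lambda>j. real (Suc j) * \<bar>c j\<bar>)"
  proof (rule summable_comparison_test')
    show "summable (\<lambda>j. norm x * (real (Suc j) * norm ((cadjoint T ^^ Suc j) x)))"
      using assms(3) by (intro summable_mult) (subst summable_Suc_iff)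
    show "norm (real (Suc j) * \<bar>c j\<bar>) \<le> norm x * (real (Suc j) * norm ((cadjoint T ^^ Suc j) x))"
      for j
      using mult_left_mono[OF Cauchy_Schwarz_ineq2[of x "(cadjoint T ^^ Suc j) x"], of "real (Suc j)"]
      unfolding c_def by (simp add: algebra_simps)
  qed
  have "summable (\<lambda>j. \<bar>c j\<bar>)"
    by (rule summable_comparison_test'[OF summable_c, of 0]) (simp add: algebra_simps)
  then have c: "summable c" by (rule summable_rabs_cancel)
  have R_le: "\<bar>R n\<bar> \<le> K" for n
    unfolding R_def K_def using summable_c by (rule tail_sums_bounded)
  have energy: "(norm (s n))\<^sup>2 = real n * A - 2 * R n - (\<Sum>k<n. d k)" for n
  proof -
    have "(\<Sum>k<n. (norm x)\<^sup>2 + 2 * (\<Sum>j<k. c j)) = (\<Sum>k<n. A - 2 * (\<Sum>j. c (j + k)))"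
      unfolding A_def suminf_minus_initial_segment[OF c] by (simp add: algebra_simps)
    also have "\<dots> = real n * A - 2 * R n"
      by (simp add: sum_subtractf R_def sum_distrib_left)
    finally show ?thesis
      using norm_orbit_sum_eq[OF assms(1), of n x] by (simp add: s_def d_def c_def)
  qed
  have d_mean: "(\<lambda>n. (\<Sum>k<n. d k) / real n) \<longlonglongrightarrow> 0"
  proof (rule tendsto_sandwich[OF _ _ tendsto_const])
    show "(\<lambda>n. (\<Sum>k=1..n. d k) / real n) \<longlonglongrightarrow> 0"
      using smalloD_tendsto[OF assms(5)] by (simp add: d_def s_def)
    \<comment> \<open>The index ranges differ by one at each end: \<open>d 0\<close> vanishes
      because the empty orbit sum is 0, and \<open>d n\<close> is nonnegative.\<close>
    have "(\<Sum>k<n. d k) \<le> (\<Sum>k=1..n. d k)" for n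
    proof -
      have "d 0 = 0" by (simp add: d_def s_def orbit_sum_def T.zero)
      then have "(\<Sum>k<n. d k) = (\<Sum>k\<in>{..<n} - {0}. d k)"
        by (intro sum.mono_neutral_right) auto
      also have "\<dots> \<le> (\<Sum>k=1..n. d k)"
        by (intro sum_mono2) (auto intro: d_nonneg)
      finally show ?thesis .
    qed
    then show "\<forall>\<^sub>F n in sequentially. (\<Sum>k<n. d k) / real n \<le> (\<Sum>k=1..n. d k) / real n"
      by (intro always_eventually allI divide_right_mono) auto
  qed (auto intro!: always_eventually sum_nonneg divide_nonneg_nonneg d_nonneg)
  have K_mean: "(\<lambda>n. C / real n) \<longlonglongrightarrow> 0" for C
    by (rule lim_const_over_n)
  \<comment> \<open>After division of \<open>energy\<close> by \<open>n\<close>, every term other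
    than \<open>A\<close> tends to 0.\<close>
  have "A = 0"
  proof -
    have "(\<lambda>n. (norm (s n) / sqrt (real n))\<^sup>2) \<longlonglongrightarrow> 0\<^sup>2"
      using smalloD_tendsto[OF assms(4)] unfolding s_def by (rule tendsto_power)
    then have s_mean: "(\<lambda>n. (norm (s n))\<^sup>2 / real n) \<longlonglongrightarrow> 0"
      by (simp add: power_divide)
    have R_mean: "(\<lambda>n. R n / real n) \<longlonglongrightarrow> 0"
      by (rule Lim_null_comparison[OF _ K_mean[of K]]) (simp add: R_le divide_right_mono)
    have "(\<lambda>n. (norm (s n))\<^sup>2 / real n + 2 * (R n / real n) + (\<Sum>k<n. d k) / real n)
        \<longlonglongrightarrow> 0 + 2 * 0 + 0"
      by (intro tendsto_intros s_mean R_mean d_mean)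
    moreover have "\<forall>\<^sub>F n in sequentially.
        (norm (s n))\<^sup>2 / real n + 2 * (R n / real n) + (\<Sum>k<n. d k) / real n = A"
      using eventually_gt_at_top[of 0]
      by eventually_elim (simp add: energy field_simps)
    ultimately have "(\<lambda>n::nat. A) \<longlonglongrightarrow> 0 + 2 * 0 + 0"
      by (rule Lim_transform_eventually)
    then show ?thesis by (simp add: LIMSEQ_const_iff)
  qed
  \<comment> \<open>With the linear term gone, the defects only decrease the right side of
    \<open>energy\<close>, leaving at most \<open>2 * K\<close>.\<close>
  have s_bound: "norm (s n) \<le> sqrt (2 * K)" for n
  proof (rule real_le_rsqrt)
    show "(norm (s n))\<^sup>2 \<le> 2 * K"
      using energy[of n] \<open>A = 0\<close> R_le[of n] sum_nonneg[of "{..<n}" d, OF d_nonneg]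
      by (simp add: abs_le_iff)
  qed
  define y where "y n = (1 / real n) *\<^sub>R (\<Sum>k<n. s k)" for n
  have y_bound: "norm (y n) \<le> sqrt (2 * K)" for n
  proof (cases "n = 0")
    case True
    then show ?thesis
      using order_trans[OF norm_ge_zero s_bound[of 0]] by (simp add: y_def)
  next
    case False
    have "norm (\<Sum>k<n. s k) \<le> real n * sqrt (2 * K)"
      using sum_norm_bound[of "{..<n}" s] s_bound by simp
    then show ?thesis using False by (simp add: y_def field_simps)
  qed
  \<comment> \<open>A zero \<open>z\<close> of \<open>B\<close> satisfies
    \<open>norm (T z) = norm z\<close>, since the square of \<open>norm (T z)\<close> is the inner
    product of \<open>z\<close> with \<open>cadjoint T (T z)\<close>.\<close>
  define B where "B u = u - cadjoint T (T u)" for u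
  have lin_B: "bounded_linear B"
    unfolding B_def
    by (intro bounded_linear_sub bounded_linear_ident T.bounded_linear_axioms
        bounded_linear_compose[OF bounded_linear_cadjoint_contraction[OF assms(1,2)]])
  interpret B: bounded_linear B by (rule lin_B)
  have "(\<lambda>n. y n - T (y n)) \<longlonglongrightarrow> x"
  proof -
    have "(\<lambda>n. (1 / real n) *\<^sub>R s n) \<longlonglongrightarrow> 0"
      by (rule Lim_null_comparison[OF _ K_mean[of "sqrt (2 * K)"]])
        (simp add: s_bound divide_right_mono)
    then have "(\<lambda>n. x - (1 / real n) *\<^sub>R s n) \<longlonglongrightarrow> x"
      using tendsto_diff[OF tendsto_const, of _ 0 _ x] by simp
    moreover have "\<forall>\<^sub>F n in sequentially. x - (1 / real n) *\<^sub>R s n = y n - T (y n)"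
      using eventually_gt_at_top[of 0]
      by eventually_elim (simp add: y_def s_def mean_orbit_sum[OF T.linear_axioms])
    ultimately show ?thesis
      by (rule Lim_transform_eventually)
  qed
  moreover have "(\<lambda>n. B (y n)) \<longlonglongrightarrow> 0"
  proof -
    have "(norm (B (y n)))\<^sup>2 \<le> (\<Sum>k<n. d k) / real n" if "n > 0" for n
    proof -
      have "B (y n) = (1 / real n) *\<^sub>R (\<Sum>k<n. B (s k))"
        by (simp add: y_def B.scaleR B.sum)
      then have "(norm (B (y n)))\<^sup>2 \<le> (\<Sum>k<n. (norm (B (s k)))\<^sup>2) / real n"
        using norm_mean_power2_le[OF that] by metis
      also have "\<dots> \<le> (\<Sum>k<n. d k) / real n"
        unfolding B_def d_def
        by (intro divide_right_mono sum_mono norm_defect_le assms) simp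
      finally show ?thesis .
    qed
    then have "(\<lambda>n. (norm (B (y n)))\<^sup>2) \<longlonglongrightarrow> 0"
      by (intro Lim_null_comparison[OF _ d_mean] eventually_mono[OF eventually_gt_at_top[of 0]]) simp
    then show ?thesis
      by (simp add: power_tendsto_0_iff tendsto_norm_zero_iff)
  qed
  \<comment> \<open>Pairing the two operators lets one use of the attainment lemma give a single
    vector solving both equations.\<close>
  ultimately have lim: "(\<lambda>n. (y n - T (y n), B (y n))) \<longlonglongrightarrow> (x, 0)"
    by (rule tendsto_Pair)
  have "bounded_linear (\<lambda>u. (u - T u, B u))"
    by (intro bounded_linear_Pair bounded_linear_sub bounded_linear_ident T.bounded_linear_axioms
        lin_B)
  then obtain z where "(z - T z, B z) = (x, 0)"
    by (rule bounded_linear_limit_attained[OF _ y_bound lim])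
  then have z: "x = z - T z" "cadjoint T (T z) = z"
    by (auto simp: B_def)
  have "norm (T z) = norm z"
    using inner_cadjoint[OF assms(1), of z "T z"] z(2) by (simp add: norm_eq)
  with z(1) show ?thesis by blast
qed

end
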